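(* Let $X$ and $Y$ be metrizable spaces. Let $D(X)$ be either $C(X)$ or $C^*(X)$, and, independently, let $D(Y)$ be either $C(Y)$ or $C^*(Y)$. Suppose that $T: D_p(X)\to D_p(Y)$ is an inversely bounded uniformly continuous surjection. If $X$ is strongly $\sigma$-scattered, then $Y$ is strongly $\sigma$-scattered.
   Context: $C(X)$ is the linear space of all continuous real-valued functions on $X$, and $C^*(X)\subset C(X)$ is the subspace of bounded functions. $D_p(X)$ denotes $D(X)$ endowed with the topology of pointwise convergence. The choices for $D(X)$ and $D(Y)$ are independent, so all four combinations are covered. A map $T: D_p(X)\to D_p(Y)$ (not necessarily linear) is uniformly continuous if for every neighborhood $U$ of the zero function in $D_p(Y)$ there is a neighborhood $V$ of the zero function in $D_p(X)$ such that $f,g\in D_p(X)$ and $f-g\in V$ imply $T(f)-T(g)\in U$. $\|f\|$ denotes the supremum norm of a bounded function $f$. A sequence $\{g_n: n\in\mathbb N\}$ of bounded continuous functions is norm bounded if there is $M>0$ with $\|g_n\|\le M$ for all $n$. A map $T: D(X)\to D(Y)$ is inversely bounded if for every norm bounded sequence $\{g_n\}\subset C^*(Y)$ there is a norm bounded sequence $\{f_n\}\subset C^*(X)$ with $T(f_n)=g_n$ for each $n\in\mathbb N$. A space is scattered if every nonempty subset $A$ of it has an isolated point in $A$ (in the subspace topology). A space is strongly $\sigma$-scattered if it can be represented as a countable union of closed scattered subspaces. *)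

theory Defs
  imports "HOL-Analysis.Analysis"
begin

text \<open>
  Spaces are abstract topologies, so they may be empty. A real-valued function on \<open>X\<close> is
  represented by its unique extension to the whole type that is \<^const>\<open>undefined\<close> off
  \<open>topspace X\<close>, as in \<^const>\<open>product_topology\<close>; with this convention equality of HOL functions
  is equality of functions on \<open>X\<close>.
\<close>

definition C_fun :: "'a topology \<Rightarrow> ('a \<Rightarrow> real) set" where
  "C_fun X = {f \<in> extensional (topspace X). continuous_map X euclideanreal f}"

definition Cb_fun :: "'a topology \<Rightarrow> ('a \<Rightarrow> real) set" where
  "Cb_fun X = {f \<in> C_fun X. bounded (f ` topspace X)}"

definition zero_fun :: "'a topology \<Rightarrow> 'a \<Rightarrow> real" where
  "zero_fun X = (\<lambda>x\<in>topspace X. 0)"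

definition diff_fun :: "'a topology \<Rightarrow> ('a \<Rightarrow> real) \<Rightarrow> ('a \<Rightarrow> real) \<Rightarrow> 'a \<Rightarrow> real" where
  "diff_fun X f g = (\<lambda>x\<in>topspace X. f x - g x)"

definition pointwise_top :: "'a topology \<Rightarrow> ('a \<Rightarrow> real) set \<Rightarrow> ('a \<Rightarrow> real) topology" where
  "pointwise_top X D = subtopology (powertop_real (topspace X)) D"

lemma topspace_pointwise_top:
  assumes "D \<subseteq> C_fun X"
  shows "topspace (pointwise_top X D) = D"
  using assms by (auto simp: pointwise_top_def C_fun_def PiE_def)

definition uniformly_continuous_Dp ::
  "'a topology \<Rightarrow> ('a \<Rightarrow> real) set \<Rightarrow> 'b topology \<Rightarrow> ('b \<Rightarrow> real) set \<Rightarrow>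
    (('a \<Rightarrow> real) \<Rightarrow> 'b \<Rightarrow> real) \<Rightarrow> bool" where
  "uniformly_continuous_Dp X D Y E T \<longleftrightarrow>
    (\<forall>U. openin (pointwise_top Y E) U \<and> zero_fun Y \<in> U \<longrightarrow>
      (\<exists>V. openin (pointwise_top X D) V \<and> zero_fun X \<in> V \<and>
        (\<forall>f\<in>D. \<forall>g\<in>D. diff_fun X f g \<in> V \<longrightarrow> diff_fun Y (T f) (T g) \<in> U)))"

text \<open>
  Inserting \<open>0\<close> only matters for the empty space, where the supremum of the empty set of reals
  would be unspecified. Only meaningful for bounded functions.
\<close>

definition sup_norm :: "'a topology \<Rightarrow> ('a \<Rightarrow> real) \<Rightarrow> real" where
  "sup_norm X f = Sup (insert 0 ((\<lambda>x. \<bar>f x\<bar>) ` topspace X))"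

definition norm_bounded_seq :: "'a topology \<Rightarrow> (nat \<Rightarrow> 'a \<Rightarrow> real) \<Rightarrow> bool" where
  "norm_bounded_seq X f \<longleftrightarrow>
    (\<forall>n. f n \<in> Cb_fun X) \<and> (\<exists>M>0. \<forall>n. sup_norm X (f n) \<le> M)"

definition inversely_bounded ::
  "'a topology \<Rightarrow> 'b topology \<Rightarrow> (('a \<Rightarrow> real) \<Rightarrow> 'b \<Rightarrow> real) \<Rightarrow> bool" where
  "inversely_bounded X Y T \<longleftrightarrow>
    (\<forall>g. norm_bounded_seq Y g \<longrightarrow> (\<exists>f. norm_bounded_seq X f \<and> (\<forall>n. T (f n) = g n)))"

definition scattered_space :: "'a topology \<Rightarrow> bool" where
  "scattered_space X \<longleftrightarrow>
    (\<forall>A. A \<subseteq> topspace X \<and> A \<noteq> {} \<longrightarrow> (\<exists>a\<in>A. openin (subtopology X A) {a}))"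

definition strongly_sigma_scattered :: "'a topology \<Rightarrow> bool" where
  "strongly_sigma_scattered X \<longleftrightarrow>
    (\<exists>\<F>. countable \<F> \<and> (\<forall>F\<in>\<F>. closedin X F \<and> scattered_space (subtopology X F)) \<and>
      \<Union>\<F> = topspace X)"

end

theory Submission
  imports Defs
begin

text \<open>
  Call a metric space \<open>\<sigma>\<close>-discrete if it is a countable union of sets \<open>S\<^sub>n\<close> with positive mutual
  distances bounded below. A scattered metric space is \<open>\<sigma>\<close>-discrete (Stone), so for metrizable
  spaces strongly \<open>\<sigma>\<close>-scattered and \<open>\<sigma>\<close>-discrete mean the same.

  Uniform continuity gives each \<open>y\<close> a finite \<open>K \<subseteq> X\<close> and a number \<open>q\<close> such that
  \<open>\<bar>T f y - T g y\<bar> \<le> q\<close> whenever \<open>\<bar>f - g\<bar> < 1\<close> on \<open>K\<close>; let \<open>\<kappa> y\<close> be such a \<open>K\<close> of least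
  cardinality. As \<open>T\<close> is inversely bounded, a pigeonhole argument shows that any given pair
  \<open>(K, q)\<close> serves only finitely many \<open>y\<close>. Minimality makes \<open>\<kappa>\<close> lower semicontinuous where \<open>q\<close>
  is bounded. Hence, among the \<open>y\<close> with \<open>\<kappa> y \<subseteq> S\<^sub>1 \<union> \<dots> \<union> S\<^sub>n\<close>, \<open>card (\<kappa> y) = p\<close> and bound \<open>q\<close>,
  the map \<open>\<kappa>\<close> is locally constant and therefore locally finite-to-one, so these \<open>y\<close> form a
  discrete subspace.
\<close>

section \<open>\<open>\<sigma>\<close>-discrete sets in metric spaces\<close>

context Metric_space
begin

text \<open>Tying the gap of a colour class to the colour itself lets several natural numbers be
  packed into one colour: \<open>prod_encode\<close> is injective and dominates both components, so
  the required gap only shrinks.\<close>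

definition discrete_colouring :: "'a set \<Rightarrow> ('a \<Rightarrow> nat) \<Rightarrow> bool" where
  "discrete_colouring F h \<longleftrightarrow>
    (\<forall>x\<in>F. \<forall>y\<in>F. x \<noteq> y \<and> h x = h y \<longrightarrow> 1 / (real (h x) + 1) \<le> d x y)"

lemma discrete_colouringD:
  assumes "discrete_colouring F h" "x \<in> F" "y \<in> F" "x \<noteq> y" "h x = h y"
  shows "1 / (real (h x) + 1) \<le> d x y"
  using assms unfolding discrete_colouring_def by blast

lemma discrete_colouring_mono:
  "discrete_colouring F h \<Longrightarrow> G \<subseteq> F \<Longrightarrow> discrete_colouring G h"
  unfolding discrete_colouring_def by blast

lemma inverse_Suc_antimono: "m \<le> n \<Longrightarrow> 1 / (real n + 1) \<le> 1 / (real m + 1)"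
  by (simp add: frac_le)

text \<open>A point is coloured by the first \<open>n\<close> with \<open>x \<in> F n\<close> paired
  with its colour there, so equal codes put two points into the same \<open>F n\<close>.\<close>

lemma discrete_colouring_Union:
  assumes "\<And>n. \<exists>h. discrete_colouring (F n) h"
  shows "\<exists>h. discrete_colouring (\<Union>n::nat. F n) h"
proof -
  obtain h where h: "\<And>n. discrete_colouring (F n) (h n)"
    using assms by metis
  define i where "i x = (LEAST n. x \<in> F n)" for x
  have i: "x \<in> F (i x)" if "x \<in> (\<Union>n. F n)" for x
    using that LeastI[of "\<lambda>n. x \<in> F n"] by (auto simp: i_def)
  define H where "H x = prod_encode (i x, h (i x) x)" for x
  have "1 / (real (H x) + 1) \<le> d x y"
    if xy: "x \<in> (\<Union>n. F n)" "y \<in> (\<Union>n. F n)" "x \<noteq> y" "H x = H y" for x y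
  proof -
    have e: "i x = i y" "h (i x) x = h (i y) y"
      using xy(4) by (auto simp: H_def prod_encode_eq)
    have "1 / (real (h (i x) x) + 1) \<le> d x y"
      using discrete_colouringD[OF h, of x "i x" y] i[OF xy(1)] i[OF xy(2)] xy(3) e by simp
    moreover have "1 / (real (H x) + 1) \<le> 1 / (real (h (i x) x) + 1)"
      unfolding H_def by (intro inverse_Suc_antimono le_prod_encode_2)
    ultimately show ?thesis by linarith
  qed
  then show ?thesis
    unfolding discrete_colouring_def by blast
qed

text \<open>
  The colour of \<open>x\<close> records the size of a ball around \<open>x\<close> inside the first member, in a
  well-ordering of the cover, that contains \<open>x\<close>. Points with different first members are then
  as far apart as that size.
\<close>
lemma discrete_colouring_locally:
  assumes "F \<subseteq> M"
    and "\<And>x. x \<in> F \<Longrightarrow> \<exists>r>0. \<exists>h. discrete_colouring (F \<inter> mball x r) h"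
  shows "\<exists>h. discrete_colouring F h"
proof -
  obtain \<rho> h where \<rho>: "\<And>x. x \<in> F \<Longrightarrow> \<rho> x > 0"
    and h: "\<And>x. x \<in> F \<Longrightarrow> discrete_colouring (F \<inter> mball x (\<rho> x)) (h x)"
    using assms(2) by metis
  obtain R where R: "well_order_on (UNIV::'a set) R"
    using well_order_on by blast
  then have wf: "wf (R - Id)" and tot: "total_on UNIV R"
    by (auto simp: well_order_on_def linear_order_on_def)
  have "\<forall>x\<in>F. \<exists>c. c \<in> F \<and> x \<in> mball c (\<rho> c) \<and>
      (\<forall>b\<in>F. (b, c) \<in> R \<and> b \<noteq> c \<longrightarrow> x \<notin> mball b (\<rho> b))"
  proof
    fix x assume "x \<in> F"
    then have "x \<in> {c \<in> F. x \<in> mball c (\<rho> c)}"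
      using \<rho> assms(1) by auto
    from wfE_min[OF wf this] obtain c where c: "c \<in> {c \<in> F. x \<in> mball c (\<rho> c)}"
      and "\<And>b. (b, c) \<in> R - Id \<Longrightarrow> b \<notin> {c \<in> F. x \<in> mball c (\<rho> c)}"
      by metis
    then have "\<forall>b\<in>F. (b, c) \<in> R \<and> b \<noteq> c \<longrightarrow> x \<notin> mball b (\<rho> b)"
      by blast
    with c show "\<exists>c. c \<in> F \<and> x \<in> mball c (\<rho> c) \<and>
        (\<forall>b\<in>F. (b, c) \<in> R \<and> b \<noteq> c \<longrightarrow> x \<notin> mball b (\<rho> b))"
      by blast
  qed
  from bchoice[OF this] obtain \<alpha> where
    \<alpha>: "\<And>x. x \<in> F \<Longrightarrow> \<alpha> x \<in> F" "\<And>x. x \<in> F \<Longrightarrow> x \<in> mball (\<alpha> x) (\<rho> (\<alpha> x))"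
    and min: "\<And>x b. \<lbrakk>x \<in> F; b \<in> F; (b, \<alpha> x) \<in> R; b \<noteq> \<alpha> x\<rbrakk> \<Longrightarrow> x \<notin> mball b (\<rho> b)"
    by blast
  have "\<exists>n. mball x (1 / (real n + 1)) \<subseteq> mball (\<alpha> x) (\<rho> (\<alpha> x))" if x: "x \<in> F" for x
  proof -
    have "openin mtopology (mball (\<alpha> x) (\<rho> (\<alpha> x)))"
      by (rule openin_mball)
    then obtain e where "e > 0" "mball x e \<subseteq> mball (\<alpha> x) (\<rho> (\<alpha> x))"
      using \<alpha>(2)[OF x] unfolding openin_mtopology by metis
    moreover obtain n where "1 / real (Suc n) < e"
      using nat_approx_posE[OF \<open>e > 0\<close>] .
    ultimately show ?thesis
      by (intro exI[of _ n]) (use mball_subset_concentric[of "1 / (real n + 1)" e x] in \<open>auto simp: add.commute\<close>)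
  qed
  then obtain n where n: "\<And>x. x \<in> F \<Longrightarrow> mball x (1 / (real (n x) + 1)) \<subseteq> mball (\<alpha> x) (\<rho> (\<alpha> x))"
    by metis
  define H where "H x = prod_encode (n x, h (\<alpha> x) x)" for x
  \<comment> \<open>The ball of \<open>\<alpha> x\<close> comes before the first ball containing
    \<open>y\<close>, so it misses \<open>y\<close>; yet it contains the
    \<open>1 / (n x + 1)\<close>-ball around \<open>x\<close>.\<close>
  have far: "1 / (real (n x) + 1) \<le> d x y"
    if "x \<in> F" "y \<in> F" "(\<alpha> x, \<alpha> y) \<in> R" "\<alpha> x \<noteq> \<alpha> y" for x y
  proof (rule ccontr)
    assume "\<not> ?thesis"
    then have "y \<in> mball x (1 / (real (n x) + 1))"
      using that assms(1) by auto
    then show False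
      using n min that \<alpha>(1) by blast
  qed
  have "1 / (real (H x) + 1) \<le> d x y"
    if xy: "x \<in> F" "y \<in> F" "x \<noteq> y" "H x = H y" for x y
  proof -
    have e: "n x = n y" "h (\<alpha> x) x = h (\<alpha> y) y"
      using xy(4) by (auto simp: H_def prod_encode_eq)
    have le: "1 / (real (H x) + 1) \<le> 1 / (real (n x) + 1)"
      "1 / (real (H x) + 1) \<le> 1 / (real (h (\<alpha> x) x) + 1)"
      unfolding H_def by (intro inverse_Suc_antimono le_prod_encode_1 le_prod_encode_2)+
    show ?thesis
    proof (cases "\<alpha> x = \<alpha> y")
      case True
      have "1 / (real (h (\<alpha> x) x) + 1) \<le> d x y"
        using xy \<alpha>(1,2)[OF xy(1)] \<alpha>(2)[OF xy(2)] e True by (intro discrete_colouringD[OF h[of "\<alpha> x"]]) auto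
      with le show ?thesis by linarith
    next
      case False
      \<comment> \<open>Whichever ball comes first supplies the gap; since \<open>n x = n y\<close>,
        both choices give the same one.\<close>
      then have "(\<alpha> x, \<alpha> y) \<in> R \<or> (\<alpha> y, \<alpha> x) \<in> R"
        using tot by (auto simp: total_on_def)
      then have "1 / (real (n x) + 1) \<le> d x y"
        using far[of x y] far[of y x] xy False e commute by auto
      with le show ?thesis by linarith
    qed
  qed
  then show ?thesis
    unfolding discrete_colouring_def by blast
qed

text \<open>Shifting the old colours up by one frees colour \<open>0\<close> for \<open>a\<close>
  and only relaxes the other gaps.\<close>

lemma discrete_colouring_insert:
  assumes "discrete_colouring G h"
  shows "\<exists>h. discrete_colouring (insert a G) h"
proof -
  define k where "k x = (if x = a then 0 else Suc (h x))" for x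
  have "1 / (real (k x) + 1) \<le> d x y"
    if "x \<in> insert a G" "y \<in> insert a G" "x \<noteq> y" "k x = k y" for x y
  proof -
    have "x \<noteq> a" "y \<noteq> a" "h x = h y"
      using that(3,4) by (auto simp: k_def split: if_splits)
    then have "1 / (real (h x) + 1) \<le> d x y"
      using that by (intro discrete_colouringD[OF assms]) auto
    moreover have "1 / (real (k x) + 1) \<le> 1 / (real (h x) + 1)"
      using \<open>x \<noteq> a\<close> by (intro inverse_Suc_antimono) (auto simp: k_def)
    ultimately show ?thesis by linarith
  qed
  then show ?thesis
    unfolding discrete_colouring_def by blast
qed

text \<open>The points with a colourable neighbourhood in \<open>F\<close> form a set
  \<open>G\<close> that is colourable as a whole by \<open>discrete_colouring_locally\<close>. An
  isolated point \<open>a\<close> of \<open>F - G\<close> would have a neighbourhood inside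
  \<open>insert a G\<close>, again colourable, and so belong to \<open>G\<close>.\<close>

lemma scattered_imp_discrete_colouring:
  assumes "F \<subseteq> M" "scattered_space (subtopology mtopology F)"
  shows "\<exists>h. discrete_colouring F h"
proof -
  define G where "G = {x \<in> F. \<exists>r>0. \<exists>h. discrete_colouring (F \<inter> mball x r) h}"
  have "\<exists>h. discrete_colouring G h"
  proof (rule discrete_colouring_locally)
    show "\<exists>r>0. \<exists>h. discrete_colouring (G \<inter> mball x r) h" if x: "x \<in> G" for x
    proof -
      obtain r h where "r > 0" "discrete_colouring (F \<inter> mball x r) h"
        using x unfolding G_def by blast
      moreover have "G \<inter> mball x r \<subseteq> F \<inter> mball x r"
        by (auto simp: G_def)
      ultimately show ?thesis
        using discrete_colouring_mono by blast
    qed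
  qed (use assms G_def in auto)
  then obtain g where g: "discrete_colouring G g" ..
  have "G = F"
  proof (rule ccontr)
    assume "G \<noteq> F"
    then have ne: "F - G \<noteq> {}" by (auto simp: G_def)
    have "F - G \<subseteq> topspace (subtopology mtopology F)"
      using assms(1) by auto
    with ne assms(2) obtain a where a: "a \<in> F - G"
      "openin (subtopology (subtopology mtopology F) (F - G)) {a}"
      unfolding scattered_space_def by blast
    then have "openin (subtopology mtopology (F - G)) {a}"
      by (simp add: subtopology_subtopology Int_absorb1)
    then obtain U where U: "openin mtopology U" "{a} = U \<inter> (F - G)"
      by (auto simp: openin_subtopology)
    then obtain r where "r > 0" "mball a r \<subseteq> U"
      unfolding openin_mtopology by blast
    with U have "F \<inter> mball a r \<subseteq> insert a G"
      by auto
    then have "\<exists>h. discrete_colouring (F \<inter> mball a r) h"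
      using discrete_colouring_insert[OF g, of a] discrete_colouring_mono by blast
    with \<open>r > 0\<close> a show False
      by (auto simp: G_def)
  qed
  with g show ?thesis by auto
qed

lemma strongly_sigma_scattered_imp_discrete_colouring:
  assumes "strongly_sigma_scattered mtopology"
  shows "\<exists>h. discrete_colouring M h"
proof -
  obtain \<F> where \<F>: "countable \<F>" "\<Union>\<F> = M"
    "\<And>F. F \<in> \<F> \<Longrightarrow> closedin mtopology F \<and> scattered_space (subtopology mtopology F)"
    using assms by (auto simp: strongly_sigma_scattered_def)
  show ?thesis
  proof (cases "\<F> = {}")
    case True
    with \<F> show ?thesis by (auto simp: discrete_colouring_def)
  next
    case False
    then have range: "range (from_nat_into \<F>) = \<F>"
      using \<F>(1) by (rule range_from_nat_into)
    have "\<exists>h. discrete_colouring (from_nat_into \<F> n) h" for n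
    proof -
      have "from_nat_into \<F> n \<in> \<F>"
        using False from_nat_into by blast
      then show ?thesis
        using \<F>(2,3) by (intro scattered_imp_discrete_colouring) auto
    qed
    then have "\<exists>h. discrete_colouring (\<Union>n. from_nat_into \<F> n) h"
      by (rule discrete_colouring_Union)
    then show ?thesis
      using range \<F>(2) by simp
  qed
qed

section \<open>Uniform separation and closed scattered pieces\<close>

lemma derived_set_of_separated:
  assumes "e > 0" and sep: "\<And>x y. \<lbrakk>x \<in> S; y \<in> S; x \<noteq> y\<rbrakk> \<Longrightarrow> e \<le> d x y"
  shows "mtopology derived_set_of S = {}"
proof -
  have False if x: "x \<in> M" and acc: "\<And>r. r > 0 \<Longrightarrow> \<exists>y\<in>S. y \<noteq> x \<and> y \<in> mball x r" for x
  proof -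
    obtain y where y: "y \<in> S" "y \<noteq> x" "y \<in> mball x (e/2)"
      using acc[of "e/2"] \<open>e > 0\<close> by auto
    then have "d x y > 0"
      by auto
    \<comment> \<open>The radius is also at most \<open>d x y\<close>, which forces
      \<open>z \<noteq> y\<close>, while both points stay within \<open>e/2\<close> of
      \<open>x\<close>.\<close>
    then obtain z where z: "z \<in> S" "z \<noteq> x" "z \<in> mball x (min (e/2) (d x y))"
      using acc[of "min (e/2) (d x y)"] \<open>e > 0\<close> by auto
    then have "z \<noteq> y" by auto
    then have "e \<le> d z y"
      using sep z y by blast
    moreover have "d z y \<le> d x z + d x y"
      using triangle[of z x y] commute z y by auto
    ultimately show False
      using y z by auto
  qed
  then show ?thesis
    unfolding metric_derived_set_of by blast
qed

text \<open>Only finitely many colours occur, and derived sets commute with finite unions. Cutting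
  at a level, rather than taking single colours, makes every finite subset of \<open>M\<close> fit
  into one such set.\<close>

lemma derived_set_of_discrete_colouring:
  assumes "discrete_colouring M h"
  shows "mtopology derived_set_of {x \<in> M. h x \<le> n} = {}"
proof -
  have "{x \<in> M. h x \<le> n} = (\<Union>((\<lambda>k. {x \<in> M. h x = k}) ` {..n}))"
    by auto
  moreover have "mtopology derived_set_of {x \<in> M. h x = k} = {}" for k
    using discrete_colouringD[OF assms]
    by (intro derived_set_of_separated[of "1 / (real k + 1)"]) force+
  ultimately show ?thesis
    by (simp add: derived_set_of_Union)
qed

end

text \<open>Each point of \<open>S\<close> has a neighbourhood meeting \<open>S\<close> nowhere
  else, and this isolation passes to all subsets of \<open>S\<close>.\<close>

lemma closedin_scattered_if_no_derived:
  assumes "S \<subseteq> topspace X" "X derived_set_of S = {}"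
  shows "closedin X S \<and> scattered_space (subtopology X S)"
proof
  show "closedin X S"
    using assms by (simp add: closedin_contains_derived_set)
  show "scattered_space (subtopology X S)"
    unfolding scattered_space_def
  proof (intro allI impI)
    fix A assume A: "A \<subseteq> topspace (subtopology X S) \<and> A \<noteq> {}"
    then have AS: "A \<subseteq> S" by auto
    obtain a where "a \<in> A" using A by auto
    then have "a \<notin> X derived_set_of S" "a \<in> topspace X"
      using assms AS by auto
    then obtain U where U: "openin X U" "a \<in> U" "\<And>y. \<lbrakk>y \<in> S; y \<in> U\<rbrakk> \<Longrightarrow> y = a"
      unfolding in_derived_set_of by blast
    then have "{a} = U \<inter> A"
      using AS \<open>a \<in> A\<close> by auto
    then have "openin (subtopology X A) {a}"
      using U(1) by (auto simp: openin_subtopology)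
    then show "\<exists>a\<in>A. openin (subtopology (subtopology X S) A) {a}"
      using AS \<open>a \<in> A\<close> by (auto simp: subtopology_subtopology Int_absorb1)
  qed
qed

text \<open>A discrete \<open>Z\<close> need not be closed. The piece \<open>P Z m\<close> holds the
  points whose \<open>1 / (m + 1)\<close>-ball meets \<open>Z\<close> nowhere else; it is uniformly
  separated, hence closed in the whole space. Local finiteness puts each point of \<open>Z\<close>
  into some piece.\<close>

lemma (in Metric_space) strongly_sigma_scattered_if_discrete_cover:
  assumes "countable \<Z>" "\<Union>\<Z> = M"
    and isolated: "\<And>Z y. \<lbrakk>Z \<in> \<Z>; y \<in> Z\<rbrakk> \<Longrightarrow> \<exists>W. openin mtopology W \<and> y \<in> W \<and> finite (W \<inter> Z)"
  shows "strongly_sigma_scattered mtopology"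
proof -
  define P where "P Z m = {y \<in> Z. mball y (1 / (real m + 1)) \<inter> Z \<subseteq> {y}}" for Z and m :: nat
  have P: "closedin mtopology (P Z m) \<and> scattered_space (subtopology mtopology (P Z m))"
    if "Z \<in> \<Z>" for Z m
  proof (rule closedin_scattered_if_no_derived)
    have "Z \<subseteq> M" using that assms(2) by auto
    then show "P Z m \<subseteq> topspace mtopology" by (auto simp: P_def)
    show "mtopology derived_set_of P Z m = {}"
    proof (rule derived_set_of_separated)
      show "1 / (real m + 1) \<le> d x y" if "x \<in> P Z m" "y \<in> P Z m" "x \<noteq> y" for x y
      proof (rule ccontr)
        assume "\<not> ?thesis"
        then have "y \<in> mball x (1 / (real m + 1)) \<inter> Z"
          using that \<open>Z \<subseteq> M\<close> by (auto simp: P_def)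
        with that show False by (auto simp: P_def)
      qed
    qed auto
  qed
  have "\<exists>m. y \<in> P Z m" if Z: "Z \<in> \<Z>" "y \<in> Z" for Z y
  proof -
    have "y \<in> M" using that assms(2) by auto
    obtain W where W: "openin mtopology W" "y \<in> W" "finite (W \<inter> Z)"
      using isolated[OF Z] by blast
    \<comment> \<open>Finite sets are closed here, so the other points of \<open>Z\<close> can be
      cut out of \<open>W\<close>.\<close>
    have "closedin mtopology (W \<inter> Z - {y})"
      using W(3) openin_subset[OF W(1)] by (intro closedin_Hausdorff_finite) (auto simp: Hausdorff_space_mtopology)
    then have "openin mtopology (W - (W \<inter> Z - {y}))"
      using W(1) by blast
    then obtain e where e: "e > 0" "mball y e \<subseteq> W - (W \<inter> Z - {y})"
      using W(2) unfolding openin_mtopology by blast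
    obtain m where "1 / real (Suc m) < e"
      using nat_approx_posE[OF \<open>e > 0\<close>] .
    then have "mball y (1 / (real m + 1)) \<subseteq> mball y e"
      by (intro mball_subset_concentric) (simp add: add.commute)
    with e Z have "y \<in> P Z m"
      by (auto simp: P_def)
    then show ?thesis ..
  qed
  then have "\<Union>\<Z> \<subseteq> \<Union>((\<lambda>(Z, m). P Z m) ` (\<Z> \<times> UNIV))"
    by blast
  moreover have "\<Union>((\<lambda>(Z, m). P Z m) ` (\<Z> \<times> UNIV)) \<subseteq> \<Union>\<Z>"
    by (auto simp: P_def)
  ultimately have "\<Union>((\<lambda>(Z, m). P Z m) ` (\<Z> \<times> UNIV)) = topspace mtopology"
    using assms(2) by simp
  moreover have "countable ((\<lambda>(Z, m). P Z m) ` (\<Z> \<times> UNIV))"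
    using assms(1) by auto
  ultimately show ?thesis
    unfolding strongly_sigma_scattered_def using P by (intro exI conjI) auto
qed

section \<open>Function spaces\<close>

lemma Cb_fun_subset_C_fun: "Cb_fun X \<subseteq> C_fun X"
  by (auto simp: Cb_fun_def)

lemma C_fun_lincomb:
  assumes "f \<in> C_fun X" "g \<in> C_fun X"
  shows "(\<lambda>x\<in>topspace X. a * f x + b * g x) \<in> C_fun X"
proof -
  have "continuous_map X euclideanreal (\<lambda>x. a * f x + b * g x)"
    using assms by (intro continuous_intros) (auto simp: C_fun_def)
  then have "continuous_map X euclideanreal (\<lambda>x\<in>topspace X. a * f x + b * g x)"
    by (rule continuous_map_eq) auto
  then show ?thesis by (auto simp: C_fun_def)
qed

lemma Cb_fun_lincomb:
  assumes "f \<in> Cb_fun X" "g \<in> Cb_fun X"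
  shows "(\<lambda>x\<in>topspace X. a * f x + b * g x) \<in> Cb_fun X"
proof -
  obtain A B where "\<And>x. x \<in> topspace X \<Longrightarrow> \<bar>f x\<bar> \<le> A" "\<And>x. x \<in> topspace X \<Longrightarrow> \<bar>g x\<bar> \<le> B"
    using assms by (auto simp: Cb_fun_def bounded_iff)
  then have "\<bar>a * f x + b * g x\<bar> \<le> \<bar>a\<bar> * A + \<bar>b\<bar> * B" if "x \<in> topspace X" for x
    using that abs_triangle_ineq[of "a * f x" "b * g x"]
      mult_left_mono[of "\<bar>f x\<bar>" A "\<bar>a\<bar>"] mult_left_mono[of "\<bar>g x\<bar>" B "\<bar>b\<bar>"]
    by (fastforce simp: abs_mult)
  then have "bounded ((\<lambda>x\<in>topspace X. a * f x + b * g x) ` topspace X)"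
    by (auto simp: bounded_iff)
  with C_fun_lincomb[of f X g] assms show ?thesis
    by (auto simp: Cb_fun_def)
qed

lemma Cb_fun_bump:
  assumes "completely_regular_space X" "openin X U" "x \<in> U"
  obtains \<phi> where "\<phi> \<in> Cb_fun X" "\<phi> x = 1" "\<And>z. z \<in> topspace X - U \<Longrightarrow> \<phi> z = 0"
    "\<And>z. z \<in> topspace X \<Longrightarrow> \<phi> z \<in> {0..1}"
proof -
  have "closedin X (topspace X - U)" "x \<in> topspace X - (topspace X - U)"
    using assms openin_subset by auto
  with assms(1) obtain f :: "'a \<Rightarrow> real" where f: "continuous_map X (top_of_set {0..1}) f"
    "f x = 0" "f ` (topspace X - U) \<subseteq> {1}"
    unfolding completely_regular_space_def by blast
  then have c: "continuous_map X euclideanreal f" and r: "\<And>z. z \<in> topspace X \<Longrightarrow> f z \<in> {0..1}"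
    by (auto simp: continuous_map_in_subtopology)
  define \<phi> where "\<phi> = (\<lambda>z\<in>topspace X. 1 - f z)"
  have "continuous_map X euclideanreal (\<lambda>z. 1 - f z)"
    using c by (intro continuous_intros)
  then have "continuous_map X euclideanreal \<phi>"
    by (rule continuous_map_eq) (auto simp: \<phi>_def)
  moreover have range: "\<phi> z \<in> {0..1}" if "z \<in> topspace X" for z
    using r[OF that] that by (auto simp: \<phi>_def)
  then have "bounded (\<phi> ` topspace X)"
    by (auto simp: bounded_iff intro!: exI[of _ 1])
  ultimately have "\<phi> \<in> Cb_fun X"
    by (auto simp: Cb_fun_def C_fun_def \<phi>_def)
  moreover have "x \<in> topspace X"
    using assms openin_subset by blast
  ultimately show thesis
    using that[of \<phi>] range f(2,3) by (auto simp: \<phi>_def)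
qed

lemma abs_le_sup_norm:
  assumes "f \<in> Cb_fun X" "x \<in> topspace X"
  shows "\<bar>f x\<bar> \<le> sup_norm X f"
proof -
  have "bdd_above ((\<lambda>x. \<bar>f x\<bar>) ` topspace X)"
    using assms by (auto simp: Cb_fun_def bounded_iff bdd_above_def)
  then show ?thesis
    unfolding sup_norm_def using assms(2) by (intro cSup_upper) auto
qed

lemma sup_norm_le:
  assumes "0 \<le> c" "\<And>x. x \<in> topspace X \<Longrightarrow> \<bar>f x\<bar> \<le> c"
  shows "sup_norm X f \<le> c"
  unfolding sup_norm_def using assms by (intro cSup_least) auto

section \<open>Neighbourhoods in the topology of pointwise convergence\<close>

lemma openin_pointwise_top_eval:
  assumes "E \<subseteq> C_fun Y" "y \<in> topspace Y"
  shows "openin (pointwise_top Y E) {u \<in> E. \<bar>u y\<bar> < 1}"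
proof -
  have "continuous_map (pointwise_top Y E) euclideanreal (\<lambda>u. u y)"
    unfolding pointwise_top_def
    by (intro continuous_map_from_subtopology continuous_map_product_projection assms(2))
  then have "openin (pointwise_top Y E) {u \<in> topspace (pointwise_top Y E). u y \<in> {-1<..<1}}"
    by (rule openin_continuous_map_preimage) auto
  moreover have "{u \<in> topspace (pointwise_top Y E). u y \<in> {-1<..<1}} = {u \<in> E. \<bar>u y\<bar> < 1}"
    using topspace_pointwise_top[OF assms(1)] by auto
  ultimately show ?thesis by simp
qed

text \<open>A basic open box constrains only finitely many coordinates; the least of their radii
  serves as \<open>e\<close>.\<close>

lemma pointwise_top_zero_nbhd:
  assumes "openin (pointwise_top X D) V" "zero_fun X \<in> V" "D \<subseteq> C_fun X"
  obtains K e where "finite K" "K \<subseteq> topspace X" "e > 0"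
    "\<And>u. u \<in> D \<Longrightarrow> (\<And>x. x \<in> K \<Longrightarrow> \<bar>u x\<bar> < e) \<Longrightarrow> u \<in> V"
proof -
  obtain W where W: "openin (powertop_real (topspace X)) W" "V = W \<inter> D"
    using assms(1) by (auto simp: pointwise_top_def openin_subtopology)
  then obtain U where U: "finite {i \<in> topspace X. U i \<noteq> UNIV}"
    "\<And>i. i \<in> topspace X \<Longrightarrow> open (U i)" "zero_fun X \<in> Pi\<^sub>E (topspace X) U"
    "Pi\<^sub>E (topspace X) U \<subseteq> W"
    using assms(2) unfolding openin_product_topology_alt by fastforce
  define K where "K = {i \<in> topspace X. U i \<noteq> UNIV}"
  have "\<exists>e>0. \<forall>t. \<bar>t\<bar> < e \<longrightarrow> t \<in> U i" if "i \<in> K" for i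
  proof -
    have i: "i \<in> topspace X" using that by (auto simp: K_def)
    then have "0 \<in> U i"
      using U(3) by (auto simp: zero_fun_def PiE_iff)
    then show ?thesis
      using U(2)[OF i] unfolding open_dist dist_real_def by fastforce
  qed
  then obtain \<epsilon> where \<epsilon>: "\<And>i. i \<in> K \<Longrightarrow> \<epsilon> i > 0" "\<And>i t. \<lbrakk>i \<in> K; \<bar>t\<bar> < \<epsilon> i\<rbrakk> \<Longrightarrow> t \<in> U i"
    by metis
  \<comment> \<open>The extra \<open>1\<close> keeps \<open>Min\<close> meaningful when
    \<open>K\<close> is empty.\<close>
  define e where "e = Min (insert 1 (\<epsilon> ` K))"
  have fin: "finite K" using U(1) by (simp add: K_def)
  have "e > 0"
    unfolding e_def using \<epsilon>(1) fin by auto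
  moreover have "u \<in> V" if u: "u \<in> D" "\<And>x. x \<in> K \<Longrightarrow> \<bar>u x\<bar> < e" for u
  proof -
    have "u i \<in> U i" if i: "i \<in> topspace X" for i
    proof (cases "i \<in> K")
      case True
      then have "e \<le> \<epsilon> i" using fin by (auto simp: e_def)
      with u(2)[OF True] \<epsilon>(2)[OF True] show ?thesis by auto
    qed (use i in \<open>auto simp: K_def\<close>)
    moreover have "u \<in> extensional (topspace X)"
      using u(1) assms(3) by (auto simp: C_fun_def)
    ultimately have "u \<in> Pi\<^sub>E (topspace X) U" by (auto simp: PiE_iff)
    then show ?thesis using U(4) W(2) u(1) by auto
  qed
  ultimately show thesis
    using that[of K e] fin by (auto simp: K_def)
qed

section \<open>Finite controlling sets\<close>

locale Dp_map =
  fixes X :: "'a topology" and D :: "('a \<Rightarrow> real) set"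
    and Y :: "'b topology" and E :: "('b \<Rightarrow> real) set"
    and T :: "('a \<Rightarrow> real) \<Rightarrow> 'b \<Rightarrow> real"
  assumes crX: "completely_regular_space X"
    and D: "D = C_fun X \<or> D = Cb_fun X"
    and E: "E = C_fun Y \<or> E = Cb_fun Y"
    and T: "\<And>f. f \<in> D \<Longrightarrow> T f \<in> E"
    and uc: "uniformly_continuous_Dp X D Y E T"
begin

text \<open>With the tolerance fixed at \<open>1\<close> and the bound a natural number, there are
  only countably many bounds to split by.\<close>

definition controls :: "'b \<Rightarrow> 'a set \<Rightarrow> nat \<Rightarrow> bool" where
  "controls y K q \<longleftrightarrow> finite K \<and> K \<subseteq> topspace X \<and>
    (\<forall>f\<in>D. \<forall>g\<in>D. (\<forall>x\<in>K. \<bar>f x - g x\<bar> < 1) \<longrightarrow> \<bar>T f y - T g y\<bar> \<le> real q)"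

lemma controlsD:
  assumes "controls y K q" "f \<in> D" "g \<in> D" "\<And>x. x \<in> K \<Longrightarrow> \<bar>f x - g x\<bar> < 1"
  shows "\<bar>T f y - T g y\<bar> \<le> real q"
  using assms unfolding controls_def by blast

lemma controls_mono: "controls y K q \<Longrightarrow> q \<le> r \<Longrightarrow> controls y K r"
  unfolding controls_def by (meson of_nat_mono order_trans)

lemma D_lincomb:
  "\<lbrakk>f \<in> D; g \<in> D\<rbrakk> \<Longrightarrow> (\<lambda>x\<in>topspace X. a * f x + b * g x) \<in> D"
  using D C_fun_lincomb[of f X g] Cb_fun_lincomb[of f X g] by auto

lemma E_subset: "E \<subseteq> C_fun Y"
  using E Cb_fun_subset_C_fun by auto

lemma D_subset: "D \<subseteq> C_fun X" and Cb_subset_D: "Cb_fun X \<subseteq> D"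
  using D Cb_fun_subset_C_fun by auto

lemma restrict_D: "f \<in> D \<Longrightarrow> restrict f (topspace X) = f"
  using D_subset by (auto simp: C_fun_def extensional_restrict)

text \<open>Uniform continuity yields a tolerance \<open>e\<close> on \<open>K\<close> within which
  \<open>T f y\<close> moves by less than \<open>1\<close>. Walking from \<open>f\<close> to
  \<open>g\<close> along their segment in \<open>N\<close> short steps trades tolerance
  \<open>e\<close> for tolerance \<open>1\<close> and bound \<open>1\<close> for bound
  \<open>N\<close>.\<close>

lemma controls_exists:
  assumes "y \<in> topspace Y"
  shows "\<exists>K q. controls y K q"
proof -
  define U where "U = {u \<in> E. \<bar>u y\<bar> < 1}"
  have "zero_fun Y \<in> E"
    using E by (auto simp: zero_fun_def C_fun_def Cb_fun_def bounded_iff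
        intro: continuous_map_eq[of _ _ "\<lambda>_. 0"])
  then have "zero_fun Y \<in> U"
    using assms by (auto simp: U_def zero_fun_def)
  moreover have "openin (pointwise_top Y E) U"
    unfolding U_def using openin_pointwise_top_eval[OF E_subset assms] .
  ultimately obtain V where V: "openin (pointwise_top X D) V" "zero_fun X \<in> V"
    "\<And>f g. \<lbrakk>f \<in> D; g \<in> D; diff_fun X f g \<in> V\<rbrakk> \<Longrightarrow> diff_fun Y (T f) (T g) \<in> U"
    using uc unfolding uniformly_continuous_Dp_def by meson
  obtain K e where K: "finite K" "K \<subseteq> topspace X" "e > 0"
    "\<And>u. u \<in> D \<Longrightarrow> (\<And>x. x \<in> K \<Longrightarrow> \<bar>u x\<bar> < e) \<Longrightarrow> u \<in> V"
    using pointwise_top_zero_nbhd[OF V(1,2) D_subset] by metis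
  have step: "\<bar>T f y - T g y\<bar> < 1"
    if "f \<in> D" "g \<in> D" "\<And>x. x \<in> K \<Longrightarrow> \<bar>f x - g x\<bar> < e" for f g
  proof -
    have "diff_fun X f g \<in> D"
      using D_lincomb[OF that(1,2), of 1 "-1"] by (simp add: diff_fun_def)
    then have "diff_fun X f g \<in> V"
      using that(3) K(2) by (intro K(4)) (auto simp: diff_fun_def)
    then have "diff_fun Y (T f) (T g) \<in> U"
      using V(3) that by blast
    then show ?thesis
      using assms by (auto simp: U_def diff_fun_def)
  qed
  obtain m where m: "1 / real (Suc m) < e"
    using nat_approx_posE[OF \<open>e > 0\<close>] .
  \<comment> \<open>As \<open>1 / N < e\<close>, each of \<open>N\<close> equal steps of a change
    below \<open>1\<close> stays below \<open>e\<close>.\<close>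
  define N where "N = Suc m"
  have "\<bar>T f y - T g y\<bar> \<le> real N"
    if fg: "f \<in> D" "g \<in> D" "\<And>x. x \<in> K \<Longrightarrow> \<bar>f x - g x\<bar> < 1" for f g
  proof -
    define s where "s j = (\<lambda>x\<in>topspace X. (1 - real j / real N) * f x + (real j / real N) * g x)" for j :: nat
    have s: "s j \<in> D" for j
      unfolding s_def by (rule D_lincomb[OF fg(1,2)])
    have "\<bar>T f y - T (s j) y\<bar> \<le> real j" for j
    proof (induction j)
      case 0
      have "s 0 = f"
        using restrict_D[OF fg(1)] by (simp add: s_def)
      then show ?case by simp
    next
      case (Suc j)
      have "\<bar>s j x - s (Suc j) x\<bar> < e" if x: "x \<in> K" for x
      proof -
        have "s j x - s (Suc j) x = (f x - g x) / real N"
          using subsetD[OF K(2) x] by (simp add: s_def algebra_simps add_divide_distrib diff_divide_distrib)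
        then have "\<bar>s j x - s (Suc j) x\<bar> = \<bar>f x - g x\<bar> / real N"
          by (simp add: abs_divide)
        also have "\<dots> \<le> 1 / real N"
          using fg(3)[OF x] by (intro divide_right_mono) auto
        finally show ?thesis using m by (simp add: N_def)
      qed
      then have "\<bar>T (s j) y - T (s (Suc j)) y\<bar> < 1"
        by (intro step[OF s s])
      with Suc show ?case by linarith
    qed
    moreover have "s N = g"
      using restrict_D[OF fg(2)] by (simp add: s_def N_def)
    ultimately show ?thesis by metis
  qed
  then have "controls y K N"
    using K unfolding controls_def by auto
  then show ?thesis by blast
qed

text \<open>
  Functions \<open>g j\<close> with \<open>g j (s j) = q + 1\<close> and \<open>g j (s i) = 0\<close> for \<open>i < j\<close> have bounded preimages,
  two of which differ by less than \<open>1\<close> on \<open>K\<close>.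
\<close>
lemma finite_controlled:
  assumes crY: "completely_regular_space Y" and t1: "t1_space Y"
    and ib: "inversely_bounded X Y T"
    and K: "finite K" "K \<subseteq> topspace X"
  shows "finite {y \<in> topspace Y. controls y K q}"
proof (rule ccontr)
  assume "infinite {y \<in> topspace Y. controls y K q}"
  then obtain s :: "nat \<Rightarrow> 'b" where "inj s" "range s \<subseteq> {y \<in> topspace Y. controls y K q}"
    using infinite_countable_subset by metis
  then have s: "inj s" "\<And>i. s i \<in> topspace Y" "\<And>i. controls (s i) K q"
    by auto
  define c where "c = real q + 1"
  have "\<exists>g\<in>Cb_fun Y. g (s j) = c \<and> (\<forall>i<j. g (s i) = 0) \<and> sup_norm Y g \<le> c" for j
  proof -
    have "closedin Y (s ` {..<j})"
      using t1 s(2) by (intro t1_space_closedin_finite[THEN iffD1, rule_format]) auto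
    then have U: "openin Y (topspace Y - s ` {..<j})" by blast
    have "s j \<in> topspace Y - s ` {..<j}"
      using s(1,2) by (auto dest: injD)
    from Cb_fun_bump[OF crY U this] obtain \<phi> where \<phi>: "\<phi> \<in> Cb_fun Y" "\<phi> (s j) = 1"
      "\<And>z. z \<in> topspace Y - (topspace Y - s ` {..<j}) \<Longrightarrow> \<phi> z = 0"
      "\<And>z. z \<in> topspace Y \<Longrightarrow> \<phi> z \<in> {0..1}" by metis
    define g where "g = (\<lambda>z\<in>topspace Y. c * \<phi> z + 0 * \<phi> z)"
    have "g \<in> Cb_fun Y"
      unfolding g_def by (rule Cb_fun_lincomb[OF \<phi>(1,1)])
    moreover have "sup_norm Y g \<le> c"
    proof (rule sup_norm_le)
      show "\<bar>g x\<bar> \<le> c" if "x \<in> topspace Y" for x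
        using \<phi>(4)[OF that] that mult_left_le[of "\<phi> x" c] by (auto simp: g_def c_def abs_mult)
    qed (simp add: c_def)
    ultimately show ?thesis
      using \<phi>(2,3) s(2) by (intro bexI[of _ g]) (auto simp: g_def)
  qed
  then obtain g where g: "\<And>j. g j \<in> Cb_fun Y" "\<And>j. g j (s j) = c"
    "\<And>i j. i < j \<Longrightarrow> g j (s i) = 0" "\<And>j. sup_norm Y (g j) \<le> c"
    by metis
  have "norm_bounded_seq Y g"
    unfolding norm_bounded_seq_def using g(1,4) by (auto intro!: exI[of _ c] simp: c_def)
  then obtain f where "norm_bounded_seq X f" and Tf: "\<And>n. T (f n) = g n"
    using ib unfolding inversely_bounded_def by blast
  then obtain B where f: "\<And>n. f n \<in> Cb_fun X" and B: "\<And>n. sup_norm X (f n) \<le> B"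
    unfolding norm_bounded_seq_def by blast
  have bound: "\<bar>f n x\<bar> \<le> B" if "x \<in> K" for n x
    using abs_le_sup_norm[OF f, of x n] B[of n] that K(2) by force
  \<comment> \<open>Pigeonhole on integer parts: the common bound \<open>B\<close> leaves finitely
    many cells, and reals with equal floors differ by less than \<open>1\<close>.\<close>
  define cell where "cell n = (\<lambda>x\<in>K. \<lfloor>f n x\<rfloor>)" for n
  have "range cell \<subseteq> K \<rightarrow>\<^sub>E {\<lfloor>-B\<rfloor>..\<lfloor>B\<rfloor>}"
    using bound by (force simp: cell_def abs_le_iff intro!: floor_mono)
  moreover have "finite (K \<rightarrow>\<^sub>E {\<lfloor>-B\<rfloor>..\<lfloor>B\<rfloor>})"
    using K(1) by (intro finite_PiE) auto
  ultimately have "finite (range cell)"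
    using finite_subset by blast
  then have "\<not> inj cell"
    using finite_imageD by blast
  then obtain i j where "i < j" "cell i = cell j"
    unfolding inj_def by (metis linorder_neqE_nat)
  have "\<bar>f i x - f j x\<bar> < 1" if "x \<in> K" for x
  proof -
    have "\<lfloor>f i x\<rfloor> = \<lfloor>f j x\<rfloor>"
      using fun_cong[OF \<open>cell i = cell j\<close>, of x] that by (simp add: cell_def)
    then show ?thesis by linarith
  qed
  \<comment> \<open>At \<open>s i\<close> the two images take the values \<open>c\<close> and
    \<open>0\<close>, a difference of \<open>q + 1\<close>.\<close>
  then have "\<bar>T (f i) (s i) - T (f j) (s i)\<bar> \<le> real q"
    using f Cb_subset_D by (intro controlsD[OF s(3)]) auto
  then show False
    using g(2) g(3)[OF \<open>i < j\<close>] by (simp add: Tf c_def)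
qed

text \<open>
  To pass from \<open>f\<close> to \<open>g\<close>, first change \<open>f\<close> only inside \<open>U\<close>, which \<open>T\<close> cannot feel by more than
  \<open>q\<close> at the points of \<open>B\<close>, hence neither at \<open>y\<close>.
\<close>
lemma controls_remove:
  assumes y: "controls y K r" "x \<in> K" and U: "openin X U" "x \<in> U" "U \<inter> K \<subseteq> {x}"
    and B: "\<And>z. z \<in> B \<Longrightarrow> \<exists>L. controls z L q \<and> L \<inter> U = {}"
    and cl: "y \<in> Y closure_of B"
  shows "controls y (K - {x}) (q + r)"
proof -
  have xX: "x \<in> topspace X" using U openin_subset by blast
  have "\<bar>T f y - T g y\<bar> \<le> real (q + r)"
    if fg: "f \<in> D" "g \<in> D" "\<And>z. z \<in> K - {x} \<Longrightarrow> \<bar>f z - g z\<bar> < 1" for f g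
  proof -
    obtain \<phi> where \<phi>: "\<phi> \<in> Cb_fun X" "\<phi> x = 1" "\<And>z. z \<in> topspace X - U \<Longrightarrow> \<phi> z = 0"
      using Cb_fun_bump[OF crX U(1,2)] by metis
    \<comment> \<open>\<open>h\<close> equals \<open>f\<close> off \<open>U\<close> and takes the
      value \<open>g x\<close> at \<open>x\<close>, so it is within \<open>1\<close> of
      \<open>g\<close> on all of \<open>K\<close>.\<close>
    define h where "h = (\<lambda>z\<in>topspace X. 1 * f z + (g x - f x) * \<phi> z)"
    have h: "h \<in> D"
      unfolding h_def using fg(1) \<phi>(1) Cb_subset_D by (intro D_lincomb) auto
    have h_out: "h z = f z" if "z \<in> topspace X" "z \<notin> U" for z
      using that \<phi>(3) by (simp add: h_def)
    have near: "\<bar>T f z - T h z\<bar> \<le> real q" if z: "z \<in> B" for z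
    proof -
      obtain L where L: "controls z L q" "L \<inter> U = {}" using B[OF z] by blast
      then have "L \<subseteq> topspace X" by (simp add: controls_def)
      with L(2) show ?thesis
        by (intro controlsD[OF L(1) fg(1) h]) (use h_out in \<open>auto simp: disjoint_iff subset_iff\<close>)
    qed
    have cont: "continuous_map Y euclideanreal (\<lambda>z. T f z - T h z)"
      using T[OF fg(1)] T[OF h] E_subset by (intro continuous_intros) (auto simp: C_fun_def)
    \<comment> \<open>By continuity of \<open>T f\<close> and \<open>T h\<close> the estimate is a
      closed condition, so it extends from \<open>B\<close> to its closure.\<close>
    have "closedin Y {z \<in> topspace Y. T f z - T h z \<in> {- real q..real q}}"
      using cont by (rule closedin_continuous_map_preimage) auto
    then have "Y closure_of (topspace Y \<inter> B) \<subseteq> {z \<in> topspace Y. T f z - T h z \<in> {- real q..real q}}"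
      using near by (intro closure_of_minimal) (fastforce simp: abs_le_iff)+
    then have "\<bar>T f y - T h y\<bar> \<le> real q"
      using cl closure_of_restrict[of Y B] by (auto simp: abs_le_iff)
    moreover have "\<bar>T h y - T g y\<bar> \<le> real r"
    proof (rule controlsD[OF y(1) h fg(2)])
      show "\<bar>h z - g z\<bar> < 1" if z: "z \<in> K" for z
      proof (cases "z = x")
        case True
        then show ?thesis using \<phi>(2) xX by (simp add: h_def)
      next
        case False
        then have "z \<notin> U" "z \<in> topspace X"
          using z U(3) y(1) by (auto simp: controls_def)
        then show ?thesis using h_out fg(3)[of z] z False by simp
      qed
    qed
    ultimately show ?thesis by simp
  qed
  then show ?thesis
    using y(1) unfolding controls_def by blast
qed

text \<open>If \<open>y\<close> were a limit of points \<open>z\<close> with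
  \<open>x \<notin> \<kappa> z\<close> for some \<open>x \<in> \<kappa> y\<close>, then
  \<open>x\<close> could be removed from \<open>\<kappa> y\<close>, as \<open>x\<close> is isolated
  in \<open>S\<close>; this contradicts minimality. So
  \<open>\<kappa> y \<subseteq> \<kappa> z\<close> for all \<open>z\<close> in \<open>Z\<close> near
  \<open>y\<close>.\<close>

lemma locally_finite_controlled:
  assumes fin: "\<And>K. \<lbrakk>finite K; K \<subseteq> topspace X\<rbrakk> \<Longrightarrow> finite {y \<in> topspace Y. controls y K q}"
    and \<kappa>: "\<And>y. y \<in> Z \<Longrightarrow> controls y (\<kappa> y) q"
    and min: "\<And>y K r. \<lbrakk>y \<in> Z; controls y K r\<rbrakk> \<Longrightarrow> card (\<kappa> y) \<le> card K"
    and Z: "Z \<subseteq> topspace Y" "\<And>y. y \<in> Z \<Longrightarrow> card (\<kappa> y) = p" "\<And>y. y \<in> Z \<Longrightarrow> \<kappa> y \<subseteq> S"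
    and S: "X derived_set_of S = {}"
    and y: "y \<in> Z"
  shows "\<exists>W. openin Y W \<and> y \<in> W \<and> finite (W \<inter> Z)"
proof -
  have fin_\<kappa>: "finite (\<kappa> z)" "\<kappa> z \<subseteq> topspace X" if "z \<in> Z" for z
    using \<kappa>[OF that] by (auto simp: controls_def)
  define B where "B x = {z \<in> Z. x \<notin> \<kappa> z}" for x
  have notin: "y \<notin> Y closure_of B x" if x: "x \<in> \<kappa> y" for x
  proof
    assume cl: "y \<in> Y closure_of B x"
    have "x \<notin> X derived_set_of S" "x \<in> topspace X"
      using S fin_\<kappa>[OF y] x by auto
    then obtain U where U: "openin X U" "x \<in> U" "\<And>z. \<lbrakk>z \<in> S; z \<in> U\<rbrakk> \<Longrightarrow> z = x"
      unfolding in_derived_set_of by blast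
    \<comment> \<open>Removal doubles the bound, which is why minimality has to range over every
      bound \<open>r\<close>.\<close>
    have "controls y (\<kappa> y - {x}) (q + q)"
    proof (rule controls_remove[OF \<kappa>[OF y] x U(1,2) _ _ cl])
      show "U \<inter> \<kappa> y \<subseteq> {x}" using U(3) Z(3)[OF y] by auto
      show "\<exists>L. controls z L q \<and> L \<inter> U = {}" if "z \<in> B x" for z
      proof (intro exI conjI)
        show "controls z (\<kappa> z) q" using that \<kappa> by (simp add: B_def)
        show "\<kappa> z \<inter> U = {}" using that U(3) Z(3)[of z] by (auto simp: B_def)
      qed
    qed
    then have "card (\<kappa> y) \<le> card (\<kappa> y - {x})"
      by (rule min[OF y])
    with x fin_\<kappa>[OF y] show False
      by (metis card_Diff1_less not_less)
  qed
  define W where "W = topspace Y - (\<Union>x\<in>\<kappa> y. Y closure_of B x)"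
  have "closedin Y (\<Union>x\<in>\<kappa> y. Y closure_of B x)"
    using fin_\<kappa>[OF y] by (intro closedin_Union) auto
  then have "openin Y W" by (auto simp: W_def)
  moreover have "y \<in> W" using notin y Z(1) by (auto simp: W_def)
  moreover have "W \<inter> Z \<subseteq> {z \<in> topspace Y. controls z (\<kappa> y) q}"
  proof
    fix z assume z: "z \<in> W \<inter> Z"
    have "x \<in> \<kappa> z" if x: "x \<in> \<kappa> y" for x
    proof (rule ccontr)
      assume "x \<notin> \<kappa> z"
      then have "z \<in> topspace Y \<inter> B x" using z Z(1) by (auto simp: B_def)
      then have "z \<in> Y closure_of B x" using closure_of_subset_Int by (rule subsetD[rotated])
      with z x show False by (auto simp: W_def)
    qed
    \<comment> \<open>Both sets have cardinality \<open>p\<close>, so inclusion is equality.\<close>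
    then have "\<kappa> y = \<kappa> z"
      using fin_\<kappa>[of z] Z(2)[of z] Z(2)[OF y] z by (intro card_seteq) auto
    then show "z \<in> {z \<in> topspace Y. controls z (\<kappa> y) q}"
      using z \<kappa>[of z] Z(1) by auto
  qed
  then have "finite (W \<inter> Z)"
    using fin[of "\<kappa> y"] fin_\<kappa>[OF y] finite_subset by blast
  ultimately show ?thesis by blast
qed

end

section \<open>Assembling the countable cover of \<open>Y\<close>\<close>

theorem theorem4p8:
  fixes X :: "'a topology" and Y :: "'b topology"
    and D :: "('a \<Rightarrow> real) set" and E :: "('b \<Rightarrow> real) set"
    and T :: "('a \<Rightarrow> real) \<Rightarrow> ('b \<Rightarrow> real)"
  assumes "metrizable_space X" and "metrizable_space Y"
    and "D = C_fun X \<or> D = Cb_fun X"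
    and "E = C_fun Y \<or> E = Cb_fun Y"
    and "T ` D = E"
    and "uniformly_continuous_Dp X D Y E T"
    and "inversely_bounded X Y T"
    and "strongly_sigma_scattered X"
  shows "strongly_sigma_scattered Y"
proof -
  interpret Dp_map X D Y E T
    by unfold_locales (use assms metrizable_imp_completely_regular_space in auto)
  obtain M d where X: "Metric_space M d" "X = Metric_space.mtopology M d"
    using assms(1) unfolding metrizable_space_def by blast
  obtain N e where Y: "Metric_space N e" "Y = Metric_space.mtopology N e"
    using assms(2) unfolding metrizable_space_def by blast
  interpret X: Metric_space M d by fact
  interpret Y: Metric_space N e by fact
  have topM: "topspace X = M" and topN: "topspace Y = N"
    using X(2) Y(2) by simp_all
  obtain c where c: "X.discrete_colouring M c"
    using X.strongly_sigma_scattered_imp_discrete_colouring assms(8) X(2) by blast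
  define S where "S n = {x \<in> M. c x \<le> n}" for n
  have S: "X derived_set_of S n = {}" for n
    unfolding S_def X(2) by (rule X.derived_set_of_discrete_colouring[OF c])
  \<comment> \<open>The cardinality is minimised over all bounds at once; \<open>\<theta> y\<close>
    is then any bound that goes with the chosen set.\<close>
  have "\<exists>K. (\<exists>q. controls y K q) \<and> (\<forall>L. (\<exists>q. controls y L q) \<longrightarrow> card K \<le> card L)"
    if "y \<in> topspace Y" for y
    using controls_exists[OF that] ex_has_least_nat[of "\<lambda>K. \<exists>q. controls y K q" _ card] by blast
  then obtain \<kappa> \<theta> where \<kappa>: "\<And>y. y \<in> topspace Y \<Longrightarrow> controls y (\<kappa> y) (\<theta> y)"
    and min: "\<And>y L q. \<lbrakk>y \<in> topspace Y; controls y L q\<rbrakk> \<Longrightarrow> card (\<kappa> y) \<le> card L"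
    by metis
  \<comment> \<open>Countably many pieces, each with a fixed cardinality, a common bound and
    controlling sets inside one \<open>S n\<close>.\<close>
  define Z where "Z = (\<lambda>(p, q, n). {y \<in> topspace Y. card (\<kappa> y) = p \<and> \<theta> y \<le> q \<and> \<kappa> y \<subseteq> S n})"
  show ?thesis
    unfolding Y(2)
  proof (rule Y.strongly_sigma_scattered_if_discrete_cover)
    show "countable (range Z)" by simp
    have "\<exists>p q n. y \<in> Z (p, q, n)" if y: "y \<in> topspace Y" for y
    proof -
      have "finite (\<kappa> y)" "\<kappa> y \<subseteq> M"
        using \<kappa>[OF y] topM by (simp_all add: controls_def)
      \<comment> \<open>The largest colour on \<open>\<kappa> y\<close> is a sufficient level; for
        empty \<open>\<kappa> y\<close> the value of \<open>Max {}\<close> is irrelevant.\<close>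
      then have "\<kappa> y \<subseteq> S (Max (c ` \<kappa> y))"
        by (auto simp: S_def)
      with y show ?thesis by (auto simp: Z_def)
    qed
    then have "topspace Y \<subseteq> \<Union> (range Z)" by blast
    moreover have "\<Union> (range Z) \<subseteq> topspace Y" by (auto simp: Z_def)
    ultimately show "\<Union> (range Z) = N" using topN by blast
    show "\<exists>W. openin Y.mtopology W \<and> y \<in> W \<and> finite (W \<inter> A)" if A: "A \<in> range Z" "y \<in> A" for A y
    proof -
      obtain p q n where "A = Z (p, q, n)" using A(1) by auto
      then have A_eq: "A = {y \<in> topspace Y. card (\<kappa> y) = p \<and> \<theta> y \<le> q \<and> \<kappa> y \<subseteq> S n}"
        by (simp add: Z_def)
      show ?thesis
        unfolding Y(2)[symmetric]
      proof (rule locally_finite_controlled[OF _ _ _ _ _ _ S A(2)])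
        show "finite {y \<in> topspace Y. controls y K q}" if "finite K" "K \<subseteq> topspace X" for K
          using assms(2,7) that
          by (intro finite_controlled metrizable_imp_completely_regular_space metrizable_imp_t1_space)
        show "controls y (\<kappa> y) q" if "y \<in> A" for y
          using that controls_mono[OF \<kappa>] by (simp add: A_eq)
        show "card (\<kappa> y) \<le> card K" if "y \<in> A" "controls y K r" for y K r
          using that min[of y K r] by (simp add: A_eq)
      qed (auto simp: A_eq)
    qed
  qed
qed

end
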